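(* Let $m,n$ be positive integers. For every matrix $(a_{ij})\in\mathbb{R}^{m\times n}$ there exists a unique polynomial $p\in\mathcal{P}_m^n$ such that $p(i,j)=a_{ij}$ for all $(i,j)\in\{1,\ldots,m\}\times\{1,\ldots,n\}$, and it is given by $$p(x,y)=\sum_{r=0}^{m-1}\binom{x-1}{r}\Delta^r p_1(y),$$ where $\Delta^0p_1(y)=p_1(y)$, $$\Delta^r p_1(y)=\sum_{\beta=0}^{r}(-1)^{\beta}\binom{r}{\beta}p_{r+1-\beta}(y)\quad\text{for all }r=1,2,\ldots,m-1,$$ and $$p_k(y)=\sum_{r=0}^{n-1}\binom{y-1}{r}\Delta^r a_{k1}\quad\text{for all }k=1,2,\ldots,m,$$ where $\Delta^0a_{k1}=a_{k1}$ and $$\Delta^r a_{k1}=\sum_{\alpha=0}^{r}(-1)^{\alpha}\binom{r}{\alpha}a_{k(r+1-\alpha)}\quad\text{for all }r=1,2,\ldots,n-1.$$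
   Context: $\mathcal{P}_m^n$ denotes the tensor product space $\Pi_{m-1}\otimes\Pi_{n-1}$ of bivariate real polynomials, i.e. the set of all polynomials of the form $p(x,y)=\sum_{k_1=0}^{m-1}\sum_{k_2=0}^{n-1}\lambda_{k_1,k_2}x^{k_1}y^{k_2}$ with $\lambda_{k_1,k_2}\in\mathbb{R}$. For a real (or polynomial) argument $z$ and integer $r\ge 0$, $\binom{z}{r}=\frac{z(z-1)\cdots(z-r+1)}{r!}$, with $\binom{z}{0}=1$. The entry in row $k$ and column $l$ of the matrix is written $a_{kl}$, so $a_{k(r+1-\alpha)}$ is the entry in row $k$, column $r+1-\alpha$. *)

theory Defs
  imports Complex_Main "HOL-Computational_Algebra.Polynomial"
begin

text \<open>
  A bivariate real polynomial is a \<^typ>\<open>real poly poly\<close>: the outer indeterminate is \<open>x\<close>, and the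
  coefficients are polynomials in \<open>y\<close>.
\<close>

definition eval2 :: "real poly poly \<Rightarrow> real \<Rightarrow> real \<Rightarrow> real" where
  "eval2 p x y = poly (poly p [:x:]) y"

definition tensor_polys :: "nat \<Rightarrow> nat \<Rightarrow> real poly poly set" where
  "tensor_polys m n =
     {p. \<exists>c :: nat \<Rightarrow> nat \<Rightarrow> real. p = (\<Sum>k1<m. \<Sum>k2<n. monom (monom (c k1 k2) k2) k1)}"

lemma eval2_monom_sum:
  "eval2 (\<Sum>k1<m. \<Sum>k2<n. monom (monom (c k1 k2) k2) k1) x y
     = (\<Sum>k1<m. \<Sum>k2<n. c k1 k2 * x ^ k1 * y ^ k2)"
  by (simp add: eval2_def poly_sum poly_monom mult_ac)

text \<open>
  \<open>diff1 r f\<close> is the forward difference \<open>\<Delta>\<^sup>r f\<^sub>1\<close> at the first index of a sequence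
  \<open>f\<^sub>1, f\<^sub>2, \<dots>\<close>.  The sum also covers \<open>r = 0\<close>, and since \<open>\<beta> \<le> r\<close> the subtraction
  never truncates.
\<close>

definition diff1 :: "nat \<Rightarrow> (nat \<Rightarrow> real) \<Rightarrow> real" where
  "diff1 r f = (\<Sum>\<beta>=0..r. (- 1) ^ \<beta> * real (r choose \<beta>) * f (r + 1 - \<beta>))"

lemma diff1_0: "diff1 0 f = f 1"
  by (simp add: diff1_def)

text \<open>
  An \<open>m \<times> n\<close> matrix is a function \<open>a\<close> of which only the entries \<open>a i j\<close> with
  \<open>1 \<le> i \<le> m\<close> and \<open>1 \<le> j \<le> n\<close> matter.
\<close>

definition row_poly :: "nat \<Rightarrow> (nat \<Rightarrow> nat \<Rightarrow> real) \<Rightarrow> nat \<Rightarrow> real \<Rightarrow> real" where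
  "row_poly n a k y = (\<Sum>r=0..n - 1. ((y - 1) gchoose r) * diff1 r (\<lambda>l. a k l))"

end

theory Submission
  imports Defs
begin

text \<open>
  Evaluation at \<open>y = j\<close> turns a polynomial of the tensor space that vanishes on the grid into a
  univariate one of degree below \<open>m\<close> with \<open>m\<close> roots, so all its coefficients vanish at \<open>n\<close> points
  and are zero in turn.  This gives uniqueness.  Existence and the formula follow by applying
  Newton's forward difference formula in \<open>y\<close> and then in \<open>x\<close>; the formula itself is proved by
  induction from Pascal's rule and \<open>\<Delta>\<^sup>r\<^sup>+\<^sup>1 f\<^sub>1 = \<Delta>\<^sup>r f\<^sub>2 - \<Delta>\<^sup>r f\<^sub>1\<close>.
\<close>

text \<open>Pascal's rule splits the coefficients of order \<open>Suc r\<close>: one part is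
  \<open>- diff1 r f\<close>, the other is the difference of order \<open>r\<close> started one
  entry later.\<close>

lemma diff1_Suc: "diff1 (Suc r) f = diff1 r (\<lambda>k. f (Suc k)) - diff1 r f"
proof -
  have "diff1 (Suc r) f = f (Suc r + 1) +
      (\<Sum>b\<le>r. (- 1) ^ Suc b * real (Suc r choose Suc b) * f (r + 1 - b))"
    unfolding diff1_def atMost_atLeast0 [symmetric]
    by (subst sum.atMost_Suc_shift) simp
  also have "\<dots> = (f (Suc r + 1) +
      (\<Sum>b\<le>r. (- 1) ^ Suc b * real (r choose Suc b) * f (r + 1 - b))) - diff1 r f"
    by (simp add: diff1_def atMost_atLeast0 [symmetric] ring_distribs sum.distrib
        sum_negf sum_subtractf)
  \<comment> \<open>The single summand is the term for \<open>b = 0\<close>. The top term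
    \<open>b = Suc r\<close> vanishes because \<open>r choose Suc r\<close> is 0.\<close>
  also have "f (Suc r + 1) + (\<Sum>b\<le>r. (- 1) ^ Suc b * real (r choose Suc b) * f (r + 1 - b)) =
      (\<Sum>b\<le>Suc r. (- 1) ^ b * real (r choose b) * f (Suc r + 1 - b))"
    by (subst sum.atMost_Suc_shift) simp
  also have "\<dots> = diff1 r (\<lambda>k. f (Suc k))"
    by (simp add: diff1_def atMost_atLeast0 [symmetric] Suc_diff_le)
  finally show ?thesis .
qed

text \<open>Lets differences in the row index pass through the Newton sum in
  \<open>y\<close>.\<close>

lemma diff1_sum: "diff1 r (\<lambda>k. \<Sum>s\<in>S. c s * g s k) = (\<Sum>s\<in>S. c s * diff1 r (g s))"
  unfolding diff1_def sum_distrib_left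
  by (subst sum.swap) (simp add: mult_ac)

lemma newton_forward_nat: "(\<Sum>r\<le>k. real (k choose r) * diff1 r f) = f (Suc k)"
proof (induction k arbitrary: f)
  case 0
  show ?case by (simp add: diff1_0)
next
  case (Suc k)
  have "(\<Sum>r\<le>Suc k. real (Suc k choose r) * diff1 r f) =
      diff1 0 f + (\<Sum>r\<le>k. real (k choose Suc r) * diff1 (Suc r) f)
      + (\<Sum>r\<le>k. real (k choose r) * diff1 (Suc r) f)"
    by (subst sum.atMost_Suc_shift) (simp add: ring_distribs sum.distrib)
  also have "diff1 0 f + (\<Sum>r\<le>k. real (k choose Suc r) * diff1 (Suc r) f) =
      (\<Sum>r\<le>Suc k. real (k choose r) * diff1 r f)"
    by (subst sum.atMost_Suc_shift) simp
  also have "\<dots> = f (Suc k)"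
    by (simp add: Suc.IH)
  \<comment> \<open>The induction hypothesis serves both \<open>f\<close> and its shift by one
    entry, hence the arbitrary \<open>f\<close>.\<close>
  also have "(\<Sum>r\<le>k. real (k choose r) * diff1 (Suc r) f) = f (Suc (Suc k)) - f (Suc k)"
    by (simp add: diff1_Suc ring_distribs sum_subtractf Suc.IH)
  finally show ?case by simp
qed

lemma newton_forward:
  assumes "j \<in> {1..n}"
  shows "(\<Sum>r=0..n - 1. ((real j - 1) gchoose r) * diff1 r f) = f j"
proof -
  obtain k where k: "j = Suc k" "k \<le> n - 1"
    using assms by (cases j) auto
  have "(\<Sum>r=0..n - 1. ((real j - 1) gchoose r) * diff1 r f) =
      (\<Sum>r=0..n - 1. real (k choose r) * diff1 r f)"
    by (simp add: k binomial_gbinomial)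
  \<comment> \<open>For \<open>r > k\<close> the coefficient \<open>k choose r\<close> is 0, so the
    sum stops at \<open>k = j - 1\<close>.\<close>
  also have "\<dots> = (\<Sum>r\<le>k. real (k choose r) * diff1 r f)"
    using k(2) by (intro sum.mono_neutral_right) auto
  finally show ?thesis
    by (simp add: newton_forward_nat k)
qed

text \<open>The binomial coefficient of \<open>x - 1\<close> over \<open>r\<close> as a polynomial
  with roots 1, ..., r, so that its degree can be bounded.\<close>

definition newton_basis :: "nat \<Rightarrow> real poly" where
  "newton_basis r = smult (1 / fact r) (\<Prod>i=0..<r. [:- 1 - of_nat i, 1:])"

lemma poly_newton_basis: "poly (newton_basis r) x = (x - 1) gchoose r"
  by (simp add: newton_basis_def poly_prod gbinomial_prod_rev algebra_simps)

lemma degree_newton_basis: "degree (newton_basis r) \<le> r"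
  unfolding newton_basis_def
  by (rule order.trans [OF degree_smult_le], rule order.trans [OF degree_prod_sum_le]) auto

lemma coeff_monom_sum:
  "coeff (coeff (\<Sum>k1<m. \<Sum>k2<n. monom (monom (c k1 k2) k2) k1) i) j =
     (if i < m \<and> j < n then c i j else (0 :: real))"
proof -
  have "coeff (coeff (\<Sum>k1<m. \<Sum>k2<n. monom (monom (c k1 k2) k2) k1) i) j =
      (\<Sum>k1<m. \<Sum>k2<n. if k2 = j then if k1 = i then c i j else 0 else 0)"
    by (auto simp: coeff_sum intro!: sum.cong)
  then show ?thesis
    by (cases "j < n") simp_all
qed

text \<open>Together with \<open>tensor_polysD\<close> this describes the tensor space by degree
  bounds, which suit both membership proofs and root counting.\<close>

lemma tensor_polysI:
  assumes "degree p < m" and "\<And>k. degree (coeff p k) < n"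
  shows "p \<in> tensor_polys m n"
proof -
  have "coeff (coeff p i) j = 0" if "i \<ge> m \<or> j \<ge> n" for i j
    using that less_le_trans [OF assms(1)] less_le_trans [OF assms(2)]
    by (auto simp: coeff_eq_0)
  then have "p = (\<Sum>k1<m. \<Sum>k2<n. monom (monom (coeff (coeff p k1) k2) k2) k1)"
    by (intro poly_eqI) (auto simp: coeff_monom_sum not_less)
  then show ?thesis
    unfolding tensor_polys_def by (intro CollectI exI)
qed

lemma tensor_polysD:
  assumes "0 < m" "0 < n" "p \<in> tensor_polys m n"
  shows "degree p < m" and "degree (coeff p k) < n"
proof -
  obtain c :: "nat \<Rightarrow> nat \<Rightarrow> real"
    where p: "p = (\<Sum>k1<m. \<Sum>k2<n. monom (monom (c k1 k2) k2) k1)"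
    using assms(3) unfolding tensor_polys_def by blast
  have "coeff p i = 0" if "i \<ge> m" for i
    using that by (intro poly_eqI) (simp add: p coeff_monom_sum)
  \<comment> \<open>The zero polynomial has degree 0, so the strict bound relies on
    \<open>0 < m\<close>.\<close>
  then show "degree p < m"
    using assms(1) by (metis leading_coeff_neq_0 degree_0 not_le)
  have "coeff (coeff p k) i = 0" if "i \<ge> n" for i
    using that by (simp add: p coeff_monom_sum)
  then show "degree (coeff p k) < n"
    using assms(2) by (metis leading_coeff_neq_0 degree_0 not_le)
qed

text \<open>Whereas \<open>eval2\<close> substitutes \<open>x\<close> first, fixing \<open>y\<close>
  in the coefficients first leaves a univariate polynomial in \<open>x\<close>.\<close>

lemma poly_map_poly_eval: "poly (map_poly (\<lambda>c. poly c y) p) x = eval2 p x y"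
  by (induction p) (auto simp: eval2_def map_poly_pCons)

lemma poly_eqI_grid:
  fixes p q :: "real poly"
  assumes "degree p < n" "degree q < n"
    and "\<And>j. j \<in> {1..n} \<Longrightarrow> poly p (real j) = poly q (real j)"
  shows "p = q"
proof (rule poly_eqI_degree [where A = "real ` {1..n}"])
  have "card (real ` {1..n}) = n"
    by (simp add: card_image)
  then show "degree p < card (real ` {1..n})" "degree q < card (real ` {1..n})"
    using assms by simp_all
qed (use assms in auto)

lemma tensor_polys_eqI:
  assumes "0 < m" "0 < n" "p \<in> tensor_polys m n" "q \<in> tensor_polys m n"
    and "\<And>i j. i \<in> {1..m} \<Longrightarrow> j \<in> {1..n} \<Longrightarrow>
      eval2 p (real i) (real j) = eval2 q (real i) (real j)"
  shows "p = q"
proof (rule poly_eqI)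
  fix k
  have "map_poly (\<lambda>c. poly c (real j)) p = map_poly (\<lambda>c. poly c (real j)) q"
    if "j \<in> {1..n}" for j
  proof (rule poly_eqI_grid)
    show "degree (map_poly (\<lambda>c. poly c (real j)) p) < m"
      "degree (map_poly (\<lambda>c. poly c (real j)) q) < m"
      using tensor_polysD(1) [OF assms(1,2)] assms(3,4) map_poly_degree_leq le_less_trans by blast+
  qed (use assms(5) that in \<open>simp add: poly_map_poly_eval\<close>)
  \<comment> \<open>Taking the coefficient of index \<open>k\<close> commutes with evaluation at
    \<open>y = j\<close>.\<close>
  then have "poly (coeff p k) (real j) = poly (coeff q k) (real j)" if "j \<in> {1..n}" for j
    using that by (metis coeff_map_poly poly_0)
  then show "coeff p k = coeff q k"
    using tensor_polysD(2) [OF assms(1,2)] assms(3,4) by (intro poly_eqI_grid [of _ n]) simp_all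
qed

text \<open>The Newton expansion in both variables, with mixed differences of \<open>a\<close> as
  coefficients. The \<open>map_poly\<close> factor carries \<open>x\<close>, the scalar of the outer
  \<open>smult\<close> carries \<open>y\<close>.\<close>

definition newton_poly2 :: "nat \<Rightarrow> nat \<Rightarrow> (nat \<Rightarrow> nat \<Rightarrow> real) \<Rightarrow> real poly poly" where
  "newton_poly2 m n a = (\<Sum>r=0..m - 1. \<Sum>s=0..n - 1.
     smult (smult (diff1 r (\<lambda>k. diff1 s (a k))) (newton_basis s))
       (map_poly (\<lambda>c. [:c:]) (newton_basis r)))"

lemma poly_map_poly_const: "poly (map_poly (\<lambda>c. [:c:]) b) [:x:] = [:poly b x:]"
  for b :: "real poly"
  by (induction b) (auto simp: map_poly_pCons)

lemma eval2_newton_poly2: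
  "eval2 (newton_poly2 m n a) x y =
     (\<Sum>r=0..m - 1. ((x - 1) gchoose r) * diff1 r (\<lambda>k. row_poly n a k y))"
  unfolding row_poly_def diff1_sum eval2_def newton_poly2_def
  by (simp add: poly_sum poly_map_poly_const poly_newton_basis sum_distrib_left mult_ac)

lemma newton_poly2_in_tensor_polys:
  assumes "0 < m" "0 < n"
  shows "newton_poly2 m n a \<in> tensor_polys m n"
proof (rule tensor_polysI)
  have "degree (newton_poly2 m n a) \<le> m - 1"
    unfolding newton_poly2_def
    by (intro degree_sum_le finite_atLeastAtMost order.trans [OF degree_smult_le]
        order.trans [OF map_poly_degree_leq] order.trans [OF degree_newton_basis]) simp
  then show "degree (newton_poly2 m n a) < m"
    using assms by linarith
  fix k
  have "degree (coeff (newton_poly2 m n a) k) \<le> n - 1"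
    unfolding newton_poly2_def coeff_sum coeff_smult
    by (intro degree_sum_le finite_atLeastAtMost order.trans [OF degree_mult_le])
      (auto simp: coeff_map_poly intro: order.trans [OF degree_smult_le]
        order.trans [OF degree_newton_basis])
  then show "degree (coeff (newton_poly2 m n a) k) < n"
    using assms by linarith
qed

theorem corollary3p8:
  fixes m n :: nat and a :: "nat \<Rightarrow> nat \<Rightarrow> real"
  assumes "0 < m" and "0 < n"
  shows "(\<exists>!p. p \<in> tensor_polys m n \<and>
               (\<forall>i\<in>{1..m}. \<forall>j\<in>{1..n}. eval2 p (real i) (real j) = a i j)) \<and>
         (\<forall>p. p \<in> tensor_polys m n \<and>
               (\<forall>i\<in>{1..m}. \<forall>j\<in>{1..n}. eval2 p (real i) (real j) = a i j) \<longrightarrow>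
           (\<forall>x y. eval2 p x y =
             (\<Sum>r=0..m - 1. ((x - 1) gchoose r) * diff1 r (\<lambda>k. row_poly n a k y))))"
proof -
  let ?P = "\<lambda>p. p \<in> tensor_polys m n \<and>
    (\<forall>i\<in>{1..m}. \<forall>j\<in>{1..n}. eval2 p (real i) (real j) = a i j)"
  have "row_poly n a k (real j) = a k j" if "j \<in> {1..n}" for k j
    unfolding row_poly_def by (rule newton_forward [OF that])
  \<comment> \<open>At \<open>y = j\<close> the sum over \<open>r\<close> becomes Newton's formula
    for column \<open>j\<close> of \<open>a\<close>.\<close>
  then have "eval2 (newton_poly2 m n a) (real i) (real j) = a i j"
    if "i \<in> {1..m}" "j \<in> {1..n}" for i j
    unfolding eval2_newton_poly2 using that by (simp only: newton_forward)
  then have ex: "?P (newton_poly2 m n a)"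
    using newton_poly2_in_tensor_polys [OF assms] by blast
  have unique: "p = newton_poly2 m n a" if "?P p" for p
    using ex that by (intro tensor_polys_eqI [OF assms]) auto
  show ?thesis
    using ex unique eval2_newton_poly2 by blast
qed

end
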